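(* Let $n\ge1$, let $d$ be a divisor of $n$, and let $r$ be an integer with $\gcd(r,n)=1$. If $X\in\mathbb{Z}_2^n$ satisfies $X_C\in F_d(\mathbb{Z}_{2C}^n)$, then $(\delta_rX)_C\in F_d(\mathbb{Z}_{2C}^n)$.
   Context: $\mathbb{Z}_2=\{+,-\}=\{1,-1\}$ and $\mathbb{Z}_2^n$ is the group of $\pm1$ sequences $X=(x_0,\dots,x_{n-1})$, indices taken modulo $n$. $C(x_0,\dots,x_{n-1})=(x_1,\dots,x_{n-1},x_0)$ and $X_C=\{C^i(X):0\le i<n\}$ is the orbit of $X$ under the cyclic group $C_n=\langle C\rangle$; $\mathbb{Z}_{2C}^n$ is the set of all such orbits. $F_d(\mathbb{Z}_{2C}^n)$ is the collection of orbits $X_C$ with $|X_C|=d$. For $\gcd(r,n)=1$, the decimation $\delta_r$ is defined by $(\delta_rX)_i=x_{ri \bmod n}$. *)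

theory Defs
  imports Main
begin

(* A sequence (x_0, ..., x_{n-1}) is an int list, with X ! i in the role of x_i. *)
definition pm_seqs :: "nat \<Rightarrow> int list set" where
  "pm_seqs n = {X. length X = n \<and> set X \<subseteq> {1, -1}}"

(* rotate1 maps (x_0, ..., x_{n-1}) to (x_1, ..., x_{n-1}, x_0), and rotate i is its i-th iterate. *)
definition cyclic_orbit :: "int list \<Rightarrow> int list set" where
  "cyclic_orbit X = {rotate i X | i. i < length X}"

definition pm_orbits :: "nat \<Rightarrow> int list set set" where
  "pm_orbits n = cyclic_orbit ` pm_seqs n"

definition orbits_of_size :: "nat \<Rightarrow> nat \<Rightarrow> int list set set" where
  "orbits_of_size d n = {Y \<in> pm_orbits n. card Y = d}"

(* The index r * i is reduced to its residue in {0..<n}, n = length X; r may be negative. *)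
definition decimation :: "int \<Rightarrow> int list \<Rightarrow> int list" where
  "decimation r X = map (\<lambda>i. X ! nat ((r * int i) mod int (length X))) [0..<length X]"

end

(* Decimation intertwines the rotations: C^i (delta_r X) = delta_r (C^(r i) X).  As r is invertible
   modulo n, i |-> r i permutes the residues, so delta_r maps the orbit of X onto the orbit of delta_r X;
   and delta_r has the inverse delta_s with r s = 1 modulo n, so both orbits have the same size. *)
theory Submission
  imports Defs
begin

lemma length_decimation [simp]: "length (decimation r X) = length X"
  by (simp add: decimation_def)

text \<open>Indexing by an arbitrary integer \<open>k\<close> modulo the length keeps index
  arithmetic in the ring of integers. Reducing \<open>k\<close> before multiplying by
  \<open>r\<close> leaves the residue of the product unchanged.\<close>

lemma decimation_nth_mod:
  assumes "X \<noteq> []"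
  shows "decimation r X ! nat (k mod int (length X)) = X ! nat ((r * k) mod int (length X))"
  using assms by (simp add: decimation_def nat_less_iff mod_mult_right_eq)

text \<open>The counterpart for rotations, with an integer shift \<open>j\<close>, which may be
  negative.\<close>

lemma rotate_nth_mod:
  assumes "X \<noteq> []"
  shows "rotate (nat (j mod int (length X))) X ! nat (k mod int (length X))
    = X ! nat ((j + k) mod int (length X))"
proof -
  let ?n = "int (length X)"
  have "nat (j mod ?n) + nat (k mod ?n) = nat (j mod ?n + k mod ?n)"
    using assms by (simp add: nat_add_distrib)
  moreover have "nat (j mod ?n + k mod ?n) mod length X = nat ((j + k) mod ?n)"
    using assms by (simp add: nat_mod_as_int mod_add_eq)
  ultimately show ?thesis
    using assms by (simp add: nth_rotate nat_less_iff)
qed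

text \<open>Extensionality in the form that fits the two index formulas above.\<close>

lemma nth_mod_equalityI:
  assumes "length X = length Y"
    and "\<And>k::int. X ! nat (k mod int (length X)) = Y ! nat (k mod int (length X))"
  shows "X = Y"
proof (rule nth_equalityI)
  fix i assume "i < length X"
  then have "nat (int i mod int (length X)) = i"
    by simp
  with assms(2)[of "int i"] show "X ! i = Y ! i"
    by simp
qed (rule assms(1))

lemma set_decimation_subset: "set (decimation r X) \<subseteq> set X"
proof (cases "X = []")
  case False
  then have "nat (k mod int (length X)) < length X" for k
    by (simp add: nat_less_iff)
  then show ?thesis
    by (auto simp: decimation_def)
qed (simp add: decimation_def)

lemma decimation_pm_seqs: "X \<in> pm_seqs n \<Longrightarrow> decimation r X \<in> pm_seqs n"
  using set_decimation_subset[of r X] by (auto simp: pm_seqs_def)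

text \<open>Entry \<open>k\<close> of the double decimation is entry \<open>r * (s * k)\<close> of
  \<open>X\<close>, an index congruent to \<open>k\<close>. Writing \<open>1 mod\<close> on the
  right covers length 1, where the residue of 1 is 0.\<close>

lemma decimation_inverse:
  assumes "(r * s) mod int (length X) = 1 mod int (length X)"
  shows "decimation s (decimation r X) = X"
proof (cases "X = []")
  case False
  have "(r * (s * k)) mod int (length X) = k mod int (length X)" for k
    using mod_mult_left_eq[of "r * s" "int (length X)" k] mod_mult_left_eq[of 1 "int (length X)" k]
      assms by (simp add: mult.assoc)
  moreover have "decimation r X \<noteq> []"
    using False by (metis length_decimation length_0_conv)
  ultimately show ?thesis
    using False decimation_nth_mod[of "decimation r X" s]
    by (intro nth_mod_equalityI) (simp_all add: decimation_nth_mod)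
qed (simp add: decimation_def)

text \<open>With shifts ranging over all integers, the orbit can be reindexed by \<open>j\<close> to
  \<open>r * j\<close> without any bounds to check.\<close>

lemma cyclic_orbit_eq:
  assumes "X \<noteq> []"
  shows "cyclic_orbit X = range (\<lambda>j. rotate (nat (j mod int (length X))) X)"
proof -
  have "\<exists>j. rotate i X = rotate (nat (j mod int (length X))) X" if "i < length X" for i
    using that by (intro exI[of _ "int i"]) simp
  moreover have "nat (j mod int (length X)) < length X" for j
    using assms by (simp add: nat_less_iff)
  ultimately show ?thesis
    unfolding cyclic_orbit_def by blast
qed

text \<open>Entry \<open>k\<close> of either side is the entry of \<open>X\<close> at
  \<open>r * (j + k) = r * j + r * k\<close>, modulo the length.\<close>

lemma rotate_decimation:
  assumes "X \<noteq> []"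
  shows "rotate (nat (j mod int (length X))) (decimation r X)
    = decimation r (rotate (nat ((r * j) mod int (length X))) X)"
proof (rule nth_mod_equalityI)
  fix k
  have ne: "decimation r X \<noteq> []"
    using assms by (metis length_decimation length_0_conv)
  show "rotate (nat (j mod int (length X))) (decimation r X)
      ! nat (k mod int (length (rotate (nat (j mod int (length X))) (decimation r X))))
    = decimation r (rotate (nat ((r * j) mod int (length X))) X)
      ! nat (k mod int (length (rotate (nat (j mod int (length X))) (decimation r X))))"
    using rotate_nth_mod[OF ne, of j k] rotate_nth_mod[OF assms, of "r * j" "r * k"]
      decimation_nth_mod[OF assms, of r "j + k"]
      decimation_nth_mod[of "rotate (nat ((r * j) mod int (length X))) X" r k] assms
    by (simp add: distrib_left)
qed simp

lemma cyclic_orbit_decimation: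
  assumes "X \<noteq> []" and "(r * s) mod int (length X) = 1 mod int (length X)"
  shows "cyclic_orbit (decimation r X) = decimation r ` cyclic_orbit X"
proof -
  let ?n = "int (length X)"
  let ?f = "\<lambda>j. decimation r (rotate (nat (j mod ?n)) X)"
  have ne: "decimation r X \<noteq> []"
    using assms(1) by (metis length_decimation length_0_conv)
  \<comment> \<open>Every shift \<open>j\<close> is congruent to a multiple of \<open>r\<close>,
    namely \<open>r * (s * j)\<close>, so the multiples of \<open>r\<close> already give the whole
    orbit.\<close>
  have "?f j = ?f (r * (s * j))" for j
    using mod_mult_left_eq[of "r * s" ?n j] mod_mult_left_eq[of 1 ?n j] assms(2)
    by (simp add: mult.assoc)
  then have "range (\<lambda>j. ?f (r * j)) = range ?f"
    by blast
  then show ?thesis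
    using assms(1)
    by (simp add: cyclic_orbit_eq[OF ne] cyclic_orbit_eq[OF assms(1)] rotate_decimation image_image)
qed

lemma card_cyclic_orbit_decimation:
  assumes "coprime r (int (length X))"
  shows "card (cyclic_orbit (decimation r X)) = card (cyclic_orbit X)"
proof (cases "X = []")
  case False
  let ?n = "int (length X)"
  \<comment> \<open>The Bezout coefficient \<open>s\<close> is an inverse of \<open>r\<close> modulo
    the length.\<close>
  obtain s t where "s * r + t * ?n = 1"
    using bezout_int[of r ?n] assms by auto
  then have rs: "(r * s) mod ?n = 1 mod ?n"
    by (metis mod_mult_self1 mult.commute)
  \<comment> \<open>All members of the orbit have the length of \<open>X\<close>, so the single
    \<open>s\<close> undoes the decimation on each of them.\<close>
  have "inj_on (decimation r) (cyclic_orbit X)"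
  proof (rule inj_on_inverseI)
    fix Y assume "Y \<in> cyclic_orbit X"
    then have "length Y = length X"
      by (auto simp: cyclic_orbit_def)
    with rs show "decimation s (decimation r Y) = Y"
      by (simp add: decimation_inverse)
  qed
  then show ?thesis
    using cyclic_orbit_decimation[OF False rs] by (simp add: card_image)
qed (simp add: decimation_def)

theorem theorem9:
  fixes n d :: nat and r :: int and X :: "int list"
  assumes "n \<ge> 1"
    and "d dvd n"
    and "gcd r (int n) = 1"
    and "X \<in> pm_seqs n"
    and "cyclic_orbit X \<in> orbits_of_size d n"
  shows "cyclic_orbit (decimation r X) \<in> orbits_of_size d n"
proof -
  have "coprime r (int (length X))"
    using assms(3,4) by (simp add: pm_seqs_def coprime_iff_gcd_eq_1)
  then have "card (cyclic_orbit (decimation r X)) = d"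
    using assms(5) by (simp add: card_cyclic_orbit_decimation orbits_of_size_def)
  then show ?thesis
    using decimation_pm_seqs[OF assms(4)] by (simp add: orbits_of_size_def pm_orbits_def)
qed

end
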